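(* Let $H$ be an ordered graph such that $\{g_H(n):n\in\mathbb{N}\}$ is unbounded. Then every graph $G$ with a Hamiltonian path $v_1,\dots,v_n$ such that $(G,v_1\cdots v_n)$ avoids the pattern $H$ contains an induced path on $\Omega\left((\log^{(3)}n/\log^{(4)}n)^{1/3}\right)$ vertices which is increasing with respect to $v_1,\dots,v_n$. In particular $g_H(n)=\Omega\left((\log^{(3)}n/\log^{(4)}n)^{1/3}\right)$.
   Context: $\log^{(i)}$ denotes the base-2 logarithm iterated $i$ times. A path $v_{i_1}v_{i_2}\cdots v_{i_\ell}$ is increasing if $i_1<i_2<\dots<i_\ell$. For a graph $G$ with a Hamiltonian path $P=v_1,\dots,v_n$, $(G,P)$ contains the ordered graph $H$ (order $u_1,\dots,u_k$) as a pattern if there exist $1\le a_1<\dots<a_k\le n$ such that every edge $u_iu_j$ of $H$ maps to an edge $v_{a_i}v_{a_j}$ of $G-E(P)$; otherwise $(G,P)$ avoids $H$. $g_H(n)$ is the maximum integer $t$ such that for every graph $G$ with a Hamiltonian path $P$ on $n$ vertices, if $(G,P)$ avoids $H$ then $G$ contains an induced path on at least $t$ vertices. *)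

theory Defs
  imports "HOL-Library.Extended_Real"
begin

definition sgraph :: "'a set \<Rightarrow> 'a set set \<Rightarrow> bool" where
  "sgraph V E \<longleftrightarrow> finite V \<and> (\<forall>e\<in>E. e \<subseteq> V \<and> card e = 2)"

definition path_edges :: "'a list \<Rightarrow> 'a set set" where
  "path_edges vs = {{vs ! i, vs ! Suc i} | i. Suc i < length vs}"

definition hamiltonian_path :: "'a set \<Rightarrow> 'a set set \<Rightarrow> 'a list \<Rightarrow> bool" where
  "hamiltonian_path V E vs \<longleftrightarrow> distinct vs \<and> set vs = V \<and> path_edges vs \<subseteq> E"

definition induced_path :: "'a set \<Rightarrow> 'a set set \<Rightarrow> 'a list \<Rightarrow> bool" where
  "induced_path V E p \<longleftrightarrow>
     p \<noteq> [] \<and> distinct p \<and> set p \<subseteq> V \<and> {e \<in> E. e \<subseteq> set p} = path_edges p"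

definition increasing_wrt :: "'a list \<Rightarrow> 'a list \<Rightarrow> bool" where
  "increasing_wrt vs p \<longleftrightarrow>
     (\<exists>is. sorted_wrt (<) is \<and> set is \<subseteq> {..<length vs} \<and> p = map (\<lambda>i. vs ! i) is)"

text \<open>An ordered graph is given by the list \<open>us\<close> of its vertices in increasing order
  together with its edge set \<open>F\<close>.\<close>

definition ordered_graph :: "'b list \<Rightarrow> 'b set set \<Rightarrow> bool" where
  "ordered_graph us F \<longleftrightarrow> distinct us \<and> sgraph (set us) F"

definition contains_pattern ::
    "'a set set \<Rightarrow> 'a list \<Rightarrow> 'b list \<Rightarrow> 'b set set \<Rightarrow> bool" where
  "contains_pattern E vs us F \<longleftrightarrow>
     (\<exists>a :: nat \<Rightarrow> nat. strict_mono_on {..<length us} a \<and>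
        (\<forall>i<length us. a i < length vs) \<and>
        (\<forall>i<length us. \<forall>j<length us. {us ! i, us ! j} \<in> F \<longrightarrow>
           {vs ! a i, vs ! a j} \<in> E - path_edges vs))"

text \<open>Every finite graph is isomorphic to one on natural numbers, so the graphs below range
  over vertex sets of type \<open>nat set\<close>. If \<open>F\<close> is nonempty and \<open>n > 0\<close>, the set of admissible
  \<open>t\<close> is nonempty and bounded by \<open>n\<close> (a bare path avoids the pattern), so the supremum is its
  maximum. If \<open>F\<close> is empty, then for \<open>n \<ge> length us\<close> nothing avoids the pattern, every \<open>t\<close> is
  admissible, and the value is \<open>\<infinity>\<close>.\<close>

definition g_H :: "'b list \<Rightarrow> 'b set set \<Rightarrow> nat \<Rightarrow> enat" where
  "g_H us F n = Sup {enat t | t. \<forall>(V :: nat set) E vs.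
     sgraph V E \<and> card V = n \<and> hamiltonian_path V E vs \<and> \<not> contains_pattern E vs us F \<longrightarrow>
     (\<exists>p. induced_path V E p \<and> t \<le> length p)}"

definition iter_log :: "nat \<Rightarrow> real \<Rightarrow> real" where
  "iter_log i = log 2 ^^ i"

end

theory Submission
  imports Defs "HOL-Library.Ramsey" "HOL-Real_Asymp.Real_Asymp"
begin

text \<open>A half graph with its zigzag Hamiltonian path has no induced path on five vertices, so \<open>H\<close>
  is a pattern of some half graph. It therefore suffices to find a large half graph pattern when
  all increasing induced paths have at most \<open>t\<close> vertices. A shortest increasing path is
  induced, so any \<open>i < j\<close> are joined by an increasing path \<open>P(i,j)\<close> with at most \<open>t\<close> vertices.
  Colour a quadruple \<open>a < b < c < d\<close> by a pair \<open>(p,q)\<close> such that the \<open>p\<close>-th vertex of \<open>P(a,b)\<close> is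
  adjacent to the \<open>q\<close>-th vertex of \<open>P(c,d)\<close>, if there is one. On a homogeneous set of colour
  \<open>(p,q)\<close>, these vertices form a half graph. On a homogeneous set without such edges, a
  shortest increasing path in the union of the paths between consecutive points advances by at most one
  piece per step, so it has more than \<open>t\<close> vertices. With \<open>t\<^sup>2 + 1\<close> colours and homogeneous sets of size
  \<open>O(t)\<close>, the Erdos--Rado bound for quadruples is \<open>2^2^2^O(t\<^sup>3 log t)\<close>.\<close>

subsection \<open>The Erdos--Rado bound\<close>

lemma pigeonhole_fiber:
  assumes "finite S" "S \<noteq> {}" "h ` S \<subseteq> D" "finite D" "card D * k \<le> card S"
  shows "\<exists>d. k \<le> card {y\<in>S. h y = d}"
proof (rule ccontr)
  assume *: "\<not> ?thesis"
  have "D \<noteq> {}" using assms by auto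
  have "card S = card (\<Union>d\<in>D. {y\<in>S. h y = d})"
    using assms(3) by (intro arg_cong[where f = card]) auto
  also have "\<dots> \<le> (\<Sum>d\<in>D. card {y\<in>S. h y = d})"
    by (rule card_UN_le[OF assms(4)])
  also have "\<dots> < (\<Sum>d\<in>D. k)"
    using * assms(4) \<open>D \<noteq> {}\<close> by (intro sum_strict_mono) (auto simp: not_le)
  finally show False using assms(5) by simp
qed

text \<open>\<open>T\<close> grows one point at a time, and \<open>U\<close> is a reservoir of later
  points that \<open>T\<close> cannot tell apart. A step moves \<open>Min U\<close> into
  \<open>T\<close> and keeps the largest class of remaining points that give the same colours
  together with the new point. There are at most q^(M^r) classes, so a step costs a factor of at
  most \<open>2 * q ^ (M ^ r)\<close>.\<close>

lemma end_homogeneous_extension: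
  fixes f :: "nat set \<Rightarrow> 'c"
  assumes fin: "finite S" and C: "finite C" "card C \<le> q" and q: "1 \<le> q"
    and f: "f ` nsets S (Suc (Suc r)) \<subseteq> C"
    and size: "(2 * q ^ (M ^ r)) ^ M \<le> card S"
    and "m \<le> M"
  shows "\<exists>T U. T \<subseteq> S \<and> U \<subseteq> S \<and> card T = m \<and> (2 * q ^ (M ^ r)) ^ (M - m) \<le> card U \<and>
    (\<forall>x\<in>T. \<forall>y\<in>U. x < y) \<and>
    (\<forall>A\<in>nsets T (Suc r). \<forall>y\<in>T \<union> U. \<forall>z\<in>T \<union> U. Max A < y \<longrightarrow> Max A < z \<longrightarrow>
       f (insert y A) = f (insert z A))"
  using \<open>m \<le> M\<close>
proof (induction m)
  case 0
  show ?case
    by (rule exI[of _ "{}"], rule exI[of _ S]) (use size in \<open>auto simp: nsets_def\<close>)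
next
  case (Suc m)
  let ?Q = "2 * q ^ (M ^ r)"
  from Suc obtain T U where TU: "T \<subseteq> S" "U \<subseteq> S" "card T = m" "?Q ^ (M - m) \<le> card U"
    "\<And>x y. x \<in> T \<Longrightarrow> y \<in> U \<Longrightarrow> x < y"
    and hom: "\<And>A y z. \<lbrakk>A \<in> nsets T (Suc r); y \<in> T \<union> U; z \<in> T \<union> U; Max A < y; Max A < z\<rbrakk> \<Longrightarrow>
       f (insert y A) = f (insert z A)"
    by (metis Suc_leD)
  have finT: "finite T" and finU: "finite U"
    using TU fin by (auto intro: finite_subset)
  have "card U > 0" using TU(4) q by (metis gr0I le_zero_eq mult_eq_0_iff not_one_le_zero power_not_zero zero_neq_numeral)
  then have "U \<noteq> {}" by auto
  define x where "x = Min U"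
  have xU: "x \<in> U" and xmin: "\<And>y. y \<in> U \<Longrightarrow> x \<le> y"
    using \<open>U \<noteq> {}\<close> finU by (auto simp: x_def)
  define U0 where "U0 = U - {x}"
  define \<B> where "\<B> = nsets T r"
  define D where "D = (\<B> \<rightarrow>\<^sub>E C)"
  \<comment> \<open>This is the type of \<open>y\<close> over the new point \<open>x\<close>. Sets
    that omit \<open>x\<close> are already handled by the induction hypothesis, so only the
    \<open>r\<close>-subsets of \<open>T\<close> together with \<open>x\<close> have to be
    recorded.\<close>
  define h where "h y = restrict (\<lambda>B. f (insert y (insert x B))) \<B>" for y
  have fin\<B>: "finite \<B>" unfolding \<B>_def using finT by (simp add: finite_imp_finite_nsets)
  have finD: "finite D" unfolding D_def using fin\<B> C by (simp add: finite_PiE)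
  have "card \<B> \<le> M ^ r"
  proof (cases "r \<le> m")
    case True
    have "card \<B> = m choose r" unfolding \<B>_def using TU(3) by simp
    also have "\<dots> \<le> m ^ r" using True by (rule binomial_le_pow)
    also have "\<dots> \<le> M ^ r" using Suc.prems by (intro power_mono) auto
    finally show ?thesis .
  qed (simp add: \<B>_def TU(3) binomial_eq_0)
  then have "card D \<le> q ^ (M ^ r)"
    unfolding D_def card_funcsetE[OF fin\<B>] 
    by (meson C(2) le_trans power_increasing power_mono q zero_le)
  have hD: "h ` U0 \<subseteq> D"
  proof -
    have "f (insert y (insert x B)) \<in> C" if "y \<in> U0" "B \<in> \<B>" for y B
    proof -
      have "x \<notin> B" "y \<notin> B" "y \<noteq> x" using that TU(5) xU by (auto simp: U0_def \<B>_def nsets_def)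
      then have "insert y (insert x B) \<in> nsets S (Suc (Suc r))"
        using that TU xU by (auto simp: U0_def \<B>_def nsets_def)
      then show ?thesis using f by blast
    qed
    then show ?thesis by (auto simp: h_def D_def)
  qed
  define K where "K = ?Q ^ (M - Suc m)"
  have "K \<ge> 1" using q by (simp add: K_def)
  have "M - m = Suc (M - Suc m)" using Suc.prems by simp
  then have "?Q * K \<le> card U" using TU(4) by (simp only: K_def power_Suc)
  then have "2 * (q ^ (M ^ r) * K) \<le> card U" by (simp only: mult.assoc)
  \<comment> \<open>Since this number is at least 1, the factor 2 in the size of \<open>U\<close>
    pays for the removal of \<open>x\<close>.\<close>
  moreover have "1 \<le> q ^ (M ^ r) * K" using q \<open>K \<ge> 1\<close> by simp
  moreover have "card U0 = card U - 1" using xU finU by (simp add: U0_def)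
  ultimately have *: "q ^ (M ^ r) * K \<le> card U0" "card U0 \<noteq> 0" by linarith+
  have "card D * K \<le> q ^ (M ^ r) * K" using \<open>card D \<le> _\<close> by simp
  with *(1) have "card D * K \<le> card U0" by (rule le_trans[rotated])
  moreover have "U0 \<noteq> {}" using *(2) by auto
  ultimately obtain d where d: "K \<le> card {y\<in>U0. h y = d}"
    using pigeonhole_fiber[OF _ _ hD finD] finU by (auto simp: U0_def)
  define U' where "U' = {y\<in>U0. h y = d}"
  show ?case
  proof (rule exI[of _ "insert x T"], rule exI[of _ U'], intro conjI ballI impI)
    show "insert x T \<subseteq> S" "U' \<subseteq> S" using TU(1,2) xU by (auto simp: U'_def U0_def)
    have "x \<notin> T" using TU(5)[of x x] xU by auto
    then show "card (insert x T) = Suc m" using TU(3) finT by simp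
    show "?Q ^ (M - Suc m) \<le> card U'" using d by (simp add: K_def U'_def)
    show "a < y" if "a \<in> insert x T" "y \<in> U'" for a y
      using that TU(5)[of a y] xmin[of y] by (auto simp: U'_def U0_def order_less_le)
  next
    fix A y z
    assume A: "A \<in> nsets (insert x T) (Suc r)" and yz: "y \<in> insert x T \<union> U'" "z \<in> insert x T \<union> U'"
      "Max A < y" "Max A < z"
    have finA: "finite A" using A by (auto simp: nsets_def)
    show "f (insert y A) = f (insert z A)"
    proof (cases "x \<in> A")
      case False
      then have "A \<in> nsets T (Suc r)" using A by (auto simp: nsets_def)
      then show ?thesis using yz xU by (intro hom) (auto simp: U'_def U0_def)
    next
      case True
      \<comment> \<open>All of \<open>T\<close> lies below \<open>x\<close>, so points above
        \<open>x\<close> come from \<open>U'\<close>, where the type is constant.\<close>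
      then have "x < y" "x < z" using yz finA by (meson Max_ge le_less_trans)+
      then have "y \<in> U'" "z \<in> U'" using yz by (auto dest: TU(5)[OF _ xU])
      moreover have "A - {x} \<in> \<B>" using A True by (auto simp: \<B>_def nsets_def)
      moreover have "h y (A - {x}) = h z (A - {x})"
        using \<open>y \<in> U'\<close> \<open>z \<in> U'\<close> by (simp add: U'_def)
      ultimately have "f (insert y (insert x (A - {x}))) = f (insert z (insert x (A - {x})))"
        by (simp add: h_def)
      then show ?thesis using True by (simp add: insert_absorb)
    qed
  qed
qed

text \<open>The index is shifted: \<open>er q s r\<close> is the bound for colourings of sets of
  size r + 1. With M = er q s r + 1, the successor value dominates the requirement (2 q^(M^r))^M of
  the end-homogeneous construction.\<close>

fun er :: "nat \<Rightarrow> nat \<Rightarrow> nat \<Rightarrow> nat" where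
  "er q s 0 = q * s"
| "er q s (Suc r) = (2 * q) ^ (er q s r + 1) ^ Suc r"

text \<open>In an end-homogeneous set the last element of a subset can be replaced by the overall
  maximum \<open>z\<close> without changing the colour. So the colouring loses one argument by
  fixing \<open>z\<close>, and induction applies below \<open>z\<close>.\<close>

theorem erdos_rado:
  fixes f :: "nat set \<Rightarrow> 'c"
  assumes "finite S" "finite C" "card C \<le> q" "1 \<le> q" "1 \<le> s"
    and "f ` nsets S (Suc r) \<subseteq> C" and "er q s r \<le> card S"
  shows "\<exists>T c. T \<subseteq> S \<and> card T = s \<and> (\<forall>A\<in>nsets T (Suc r). f A = c)"
  using assms
proof (induction r arbitrary: f S)
  case 0
  have "(\<lambda>y. f {y}) ` S \<subseteq> C" using 0(6) by (auto simp: nsets_def image_subset_iff)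
  moreover have "card C * s \<le> card S"
    using 0(7) mult_le_mono1[OF \<open>card C \<le> q\<close>, of s] by (simp only: er.simps)
  moreover have "S \<noteq> {}" using 0 by auto
  ultimately obtain c where "s \<le> card {y\<in>S. f {y} = c}"
    using pigeonhole_fiber[OF 0(1) _ _ 0(2)] by blast
  then obtain T where "T \<subseteq> {y\<in>S. f {y} = c}" "card T = s"
    by (rule obtain_subset_with_card_n)
  then show ?case
    by (intro exI[of _ T] exI[of _ c]) (auto simp: nsets_def card_1_singleton_iff)
next
  case (Suc r)
  \<comment> \<open>The extra 1 is for the maximum \<open>z\<close>, which is removed before the
    induction hypothesis is used.\<close>
  define M where "M = er q s r + 1"
  have "(2 * q ^ (M ^ r)) ^ M \<le> ((2 * q) ^ (M ^ r)) ^ M"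
    by (intro power_mono) (simp_all add: power_mult_distrib self_le_power M_def)
  also have "\<dots> = (2 * q) ^ M ^ Suc r" by (simp only: power_Suc2 power_mult)
  also have "\<dots> = er q s (Suc r)" by (simp add: M_def)
  also have "\<dots> \<le> card S" by (rule Suc.prems)
  finally obtain T where T: "T \<subseteq> S" "card T = M" and
    hom: "\<And>A y z. \<lbrakk>A \<in> nsets T (Suc r); y \<in> T; z \<in> T; Max A < y; Max A < z\<rbrakk> \<Longrightarrow>
       f (insert y A) = f (insert z A)"
    using end_homogeneous_extension[OF Suc.prems(1-4,6), of M M] by auto
  have finT: "finite T" using T Suc.prems(1) finite_subset by blast
  have "T \<noteq> {}" using T by (auto simp: M_def)
  define z where "z = Max T"
  have z: "z \<in> T" "\<And>y. y \<in> T \<Longrightarrow> y \<le> z" using finT \<open>T \<noteq> {}\<close> by (auto simp: z_def)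
  define T0 where "T0 = T - {z}"
  have "(\<lambda>A. f (insert z A)) ` nsets T0 (Suc r) \<subseteq> C"
  proof -
    have "insert z A \<in> nsets S (Suc (Suc r))" if "A \<in> nsets T0 (Suc r)" for A
      using that T z by (auto simp: T0_def nsets_def card_insert_if)
    then show ?thesis using Suc.prems(6) by blast
  qed
  moreover have "er q s r \<le> card T0" using T z finT by (simp add: T0_def M_def)
  ultimately obtain T' c where T': "T' \<subseteq> T0" "card T' = s" "\<And>A. A \<in> nsets T' (Suc r) \<Longrightarrow> f (insert z A) = c"
    using Suc.IH[of T0 "\<lambda>A. f (insert z A)"] Suc.prems finT unfolding T0_def by blast
  have "f B = c" if B: "B \<in> nsets T' (Suc (Suc r))" for B
  proof -
    define y where "y = Max B"
    define A where "A = B - {y}"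
    have finB: "finite B" and "card B = Suc (Suc r)" using B by (auto simp: nsets_def)
    then have "B \<noteq> {}" by auto
    then have y: "y \<in> B" using finB by (simp add: y_def)
    have A: "A \<in> nsets T' (Suc r)" using B y by (auto simp: A_def nsets_def)
    then have MA: "Max A \<in> A" "finite A" by (auto simp: nsets_def card_gt_0_iff intro!: Max_in)
    then have "Max A \<le> y" "Max A \<noteq> y" using finB by (auto simp: A_def y_def)
    then have "Max A < y" by simp
    moreover have yT: "y \<in> T" using y B T' by (auto simp: nsets_def T0_def)
    moreover have "Max A < z" using \<open>Max A < y\<close> z(2)[OF yT] by simp
    moreover have "A \<in> nsets T (Suc r)" using A T' by (auto simp: nsets_def T0_def)
    ultimately have "f (insert y A) = f (insert z A)" using hom z(1) by blast
    then show ?thesis using T'(3)[OF A] y by (simp add: A_def insert_absorb)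
  qed
  then show ?case using T' T by (intro exI[of _ T'] exI[of _ c]) (auto simp: T0_def)
qed

section \<open>Size of the bound for quadruples\<close>

lemma er_3_le:
  assumes "t \<le> 2 ^ w" "3 * k + 2 \<le> t"
  shows "er (Suc (t * t)) (t + 2 + 3 * k) 3 \<le> 2 ^ 2 ^ 2 ^ (160 * w * t ^ 3)"
proof -
  have "2 \<le> t" using assms by simp
  have "1 \<le> w" using assms by (cases w) auto
  define q where "q = Suc (t * t)"
  define e where "e = er q (t + 2 + 3 * k)"
  \<comment> \<open>The base \<open>2 * q\<close> is at most 2^(4w), and \<open>e 0 + 1\<close> is
    at most 5 t^3 because the homogeneous size is at most 2t. The constant 20 is the product of this
    4 and this 5.\<close>
  define u where "u = 20 * w * t ^ 3"
  have "t * t \<le> 2 ^ (2 * w)"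
    using mult_le_mono[OF assms(1) assms(1)] by (simp add: mult_2 power_add)
  then have "t * t + 1 \<le> 2 ^ (2 * w) + 2 ^ (2 * w)" by (intro add_mono) simp_all
  then have "2 * q \<le> 4 * 2 ^ (2 * w)" by (simp add: q_def)
  also have "\<dots> = 2 ^ (2 * w + 2)" by (simp add: power_add)
  also have "\<dots> \<le> 2 ^ (4 * w)" using \<open>1 \<le> w\<close> by (intro power_increasing) auto
  finally have q: "2 * q \<le> 2 ^ (4 * w)" .
  have power: "(2 * q) ^ N \<le> 2 ^ K" if "4 * w * N \<le> K" for N K
  proof -
    have "(2 * q) ^ N \<le> (2 ^ (4 * w)) ^ N" using q by (rule power_mono) simp
    also have "\<dots> = 2 ^ (4 * w * N)" by (simp only: power_mult)
    also have "\<dots> \<le> 2 ^ K" using that by (intro power_increasing) auto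
    finally show ?thesis .
  qed
  have plus_one: "x + 1 \<le> 2 ^ (a + 1)" if "x \<le> 2 ^ a" for x a :: nat
    using add_mono[OF that, of 1 "2 ^ a"] by simp
  have "1 \<le> t ^ 3" using \<open>2 \<le> t\<close> by simp
  then have "w \<le> w * t ^ 3" by simp
  then have "4 * w \<le> u" "20 \<le> u" unfolding u_def using \<open>1 \<le> w\<close> by linarith+
  have "q \<le> 2 * t ^ 2" using \<open>2 \<le> t\<close> by (simp add: q_def power2_eq_square Suc_le_eq)
  then have "e 0 \<le> 2 * t ^ 2 * (2 * t)"
    unfolding e_def er.simps using assms(2) by (intro mult_mono) auto
  also have "\<dots> = 4 * t ^ 3" by (simp add: power2_eq_square power3_eq_cube)
  finally have "e 0 + 1 \<le> 5 * t ^ 3" using \<open>1 \<le> t ^ 3\<close> by linarith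
  then have "4 * w * (e 0 + 1) \<le> 4 * w * (5 * t ^ 3)" by (rule mult_le_mono2)
  also have "\<dots> = u" by (simp add: u_def)
  finally have "4 * w * (e 0 + 1) \<le> u" .
  moreover have "e 1 = (2 * q) ^ (e 0 + 1)" by (simp add: e_def)
  ultimately have e1: "e 1 \<le> 2 ^ u"
    using power[of "e 0 + 1"] by simp
  \<comment> \<open>From here on the factor \<open>4 * w\<close> and the outer powers 2 and 3 are
    absorbed by enlarging the topmost exponent: \<open>u\<close> becomes \<open>5 * u\<close> at
    level 2 and \<open>8 * u\<close>, that is 160 w t^3, at level 3.\<close>
  have w_u: "4 * w \<le> 2 ^ u" using \<open>4 * w \<le> u\<close> less_exp[of u] by (rule order.trans[OF _ less_imp_le])
  have "(e 1 + 1) ^ 2 \<le> (2 ^ (u + 1)) ^ 2"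
    using plus_one[OF e1] by (rule power_mono) simp
  then have "4 * w * (e 1 + 1) ^ 2 \<le> 2 ^ u * (2 ^ (u + 1)) ^ 2"
    by (rule mult_le_mono[OF w_u])
  also have "\<dots> = 2 ^ (u + (u + 1) * 2)" by (simp only: power_add power_mult)
  also have "\<dots> \<le> 2 ^ (5 * u)" using \<open>20 \<le> u\<close> by (intro power_increasing) auto
  finally have "4 * w * (e 1 + 1) ^ 2 \<le> 2 ^ (5 * u)" .
  moreover have "e 2 = (2 * q) ^ (e 1 + 1) ^ 2" by (simp add: e_def numeral_2_eq_2)
  ultimately have e2: "e 2 \<le> 2 ^ 2 ^ (5 * u)"
    using power[of "(e 1 + 1) ^ 2"] by simp
  define v :: nat where "v = 2 ^ (5 * u)"
  have "u \<le> v" unfolding v_def using less_exp[of "5 * u"] by (rule le_trans[OF _ less_imp_le, rotated]) simp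
  have "2 ^ u \<le> (2::nat) ^ v" using \<open>u \<le> v\<close> by (rule power_increasing) simp
  with w_u have w_v: "4 * w \<le> 2 ^ v" by (rule le_trans)
  have "(e 2 + 1) ^ 3 \<le> (2 ^ (v + 1)) ^ 3"
    using plus_one[OF e2] unfolding v_def by (rule power_mono) simp
  then have "4 * w * (e 2 + 1) ^ 3 \<le> 2 ^ v * (2 ^ (v + 1)) ^ 3"
    by (rule mult_le_mono[OF w_v])
  also have "\<dots> = 2 ^ (v + (v + 1) * 3)" by (simp only: power_add power_mult)
  also have "\<dots> \<le> 2 ^ (8 * v)" using \<open>20 \<le> u\<close> \<open>u \<le> v\<close> by (intro power_increasing) auto
  also have "8 * v = 2 ^ (5 * u + 3)" by (simp add: v_def power_add)
  also have "\<dots> \<le> 2 ^ (8 * u)" using \<open>20 \<le> u\<close> by (intro power_increasing) auto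
  finally have "4 * w * (e 2 + 1) ^ 3 \<le> 2 ^ 2 ^ (8 * u)" by simp
  moreover have "e 3 = (2 * q) ^ (e 2 + 1) ^ 3" by (simp add: e_def numeral_2_eq_2 numeral_3_eq_3)
  ultimately have "e 3 \<le> 2 ^ 2 ^ 2 ^ (8 * u)"
    using power[of "(e 2 + 1) ^ 3"] by simp
  moreover have "8 * u = 160 * w * t ^ 3" by (simp add: u_def)
  ultimately show ?thesis by (simp only: e_def q_def)
qed

lemma two_power_le_of_le_log:
  assumes "0 < y" "real m \<le> log 2 y"
  shows "real (2 ^ m) \<le> y"
  using assms by (simp add: le_log_iff powr_realpow)

text \<open>The constant 1/8 makes t^3 at most 1/512 of the quotient of the logarithms. As w is at
  most the fourth iterated logarithm, 160 w t^3 stays below the third one, and exponentiating three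
  times gives n.\<close>

lemma eventually_er_le:
  defines "x \<equiv> \<lambda>n::nat. 1/8 * (iter_log 3 (real n) / iter_log 4 (real n)) powr (1/3)"
  shows "eventually (\<lambda>n. er (Suc (nat \<lfloor>x n\<rfloor> * nat \<lfloor>x n\<rfloor>)) (nat \<lfloor>x n\<rfloor> + 2 + 3 * k) 3 \<le> n) at_top"
proof -
  have iter3: "iter_log 3 = (\<lambda>y. log 2 (log 2 (log 2 y)))"
    and iter4: "iter_log 4 = (\<lambda>y. log 2 (log 2 (log 2 (log 2 y))))"
    by (simp_all add: iter_log_def eval_nat_numeral fun_eq_iff)
  have "filterlim x at_top at_top" unfolding x_def iter3 iter4 by real_asymp
  then have "\<forall>\<^sub>F n in at_top. real (3 * k + 2) \<le> x n" by (simp add: filterlim_at_top)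
  \<comment> \<open>The factor 1/2 leaves room for rounding log t up to the integer
    \<open>w\<close>.\<close>
  moreover have "\<forall>\<^sub>F n in at_top. x n \<le> iter_log 3 (real n) / 2"
    unfolding x_def iter3 iter4 by real_asymp
  moreover have "\<forall>\<^sub>F n in at_top. 0 < real n" "\<forall>\<^sub>F n in at_top. 0 < log 2 (real n)"
    "\<forall>\<^sub>F n in at_top. 0 < log 2 (log 2 (real n))"
    "\<forall>\<^sub>F n in at_top. 2 < iter_log 3 (real n)"
    unfolding iter3 by real_asymp+
  ultimately show ?thesis
  proof eventually_elim
    case (elim n)
    define \<Lambda> where "\<Lambda> = iter_log 3 (real n)"
    define t where "t = nat \<lfloor>x n\<rfloor>"
    define w where "w = nat \<lceil>log 2 (real t)\<rceil>"
    have "iter_log 4 (real n) = log 2 \<Lambda>" by (simp add: \<Lambda>_def iter3 iter4)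
    then have x: "x n = 1/8 * (\<Lambda> / log 2 \<Lambda>) powr (1/3)" by (simp add: x_def \<Lambda>_def)
    have "2 < \<Lambda>" using elim by (simp add: \<Lambda>_def)
    then have "1 < log 2 \<Lambda>" by (simp add: less_log_iff)
    have t: "3 * k + 2 \<le> t" using elim(1) unfolding t_def by linarith
    have tx: "real t \<le> x n" using elim(1) unfolding t_def by linarith
    have "real t ^ 3 \<le> x n ^ 3" using tx by (intro power_mono) auto
    also have "\<dots> = 1/512 * ((\<Lambda> / log 2 \<Lambda>) powr (1/3)) powr 3"
      unfolding x power_mult_distrib using \<open>2 < \<Lambda>\<close> \<open>1 < log 2 \<Lambda>\<close>
      by (subst powr_numeral) (auto simp: power_divide)
    also have "\<dots> = 1/512 * (\<Lambda> / log 2 \<Lambda>)"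
      using \<open>2 < \<Lambda>\<close> \<open>1 < log 2 \<Lambda>\<close> by (simp add: powr_powr)
    finally have t3: "real t ^ 3 \<le> 1/512 * (\<Lambda> / log 2 \<Lambda>)" .
    have "0 < real t" using t by simp
    have "real (2 * t) \<le> \<Lambda>" using tx elim(2) by (simp add: \<Lambda>_def)
    then have "log 2 (2 * real t) \<le> log 2 \<Lambda>" using \<open>0 < real t\<close> by simp
    then have "log 2 (real t) + 1 \<le> log 2 \<Lambda>" using \<open>0 < real t\<close> by (simp add: log_mult)
    moreover have "0 \<le> log 2 (real t)" using t by simp
    ultimately have w: "real w \<le> log 2 \<Lambda>" "log 2 (real t) \<le> real w" unfolding w_def by linarith+
    have "real t \<le> 2 powr real w" using w(2) \<open>0 < real t\<close> by (simp add: log_le_iff)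
    then have "t \<le> 2 ^ w" by (simp add: powr_realpow flip: of_nat_le_iff)
    have "real (160 * w * t ^ 3) = 160 * (real w * real t ^ 3)" by simp
    also have "\<dots> \<le> 160 * (log 2 \<Lambda> * (1/512 * (\<Lambda> / log 2 \<Lambda>)))"
      using w(1) t3 \<open>1 < log 2 \<Lambda>\<close> by (intro mult_left_mono mult_mono) auto
    also have "\<dots> \<le> \<Lambda>" using \<open>2 < \<Lambda>\<close> \<open>1 < log 2 \<Lambda>\<close> by simp
    finally have "real (160 * w * t ^ 3) \<le> log 2 (log 2 (log 2 (real n)))"
      by (simp add: \<Lambda>_def iter3)
    then have "real (2 ^ 2 ^ 2 ^ (160 * w * t ^ 3)) \<le> real n"
      using elim by (intro two_power_le_of_le_log)
    then have "2 ^ 2 ^ 2 ^ (160 * w * t ^ 3) \<le> n" by (simp only: of_nat_le_iff)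
    with er_3_le[OF \<open>t \<le> 2 ^ w\<close> t] show ?case unfolding t_def by (rule le_trans)
  qed
qed

subsection \<open>Half graphs and increasing geodesics\<close>

text \<open>Even and odd vertices form the two sides: an even x is adjacent to an odd y exactly when
  x <= y + 1, so neighbourhoods are nested. The edges from an odd vertex to its successor make 0,
  ..., n-1 a Hamiltonian path.\<close>

definition half_graph :: "nat \<Rightarrow> nat set set" where
  "half_graph n = {{x, y} | x y. x < y \<and> y < n \<and> (even x \<and> odd y \<or> y = Suc x)}"

lemma half_graph_iff:
  "{x, y} \<in> half_graph n \<longleftrightarrow>
     x < n \<and> y < n \<and> x \<noteq> y \<and>
     (even x \<and> odd y \<and> x \<le> Suc y \<or> even y \<and> odd x \<and> y \<le> Suc x)"
proof
  assume "{x, y} \<in> half_graph n"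
  then show "x < n \<and> y < n \<and> x \<noteq> y \<and>
     (even x \<and> odd y \<and> x \<le> Suc y \<or> even y \<and> odd x \<and> y \<le> Suc x)"
    unfolding half_graph_def by (auto simp: doubleton_eq_iff)
next
  assume *: "x < n \<and> y < n \<and> x \<noteq> y \<and>
     (even x \<and> odd y \<and> x \<le> Suc y \<or> even y \<and> odd x \<and> y \<le> Suc x)"
  have "x < y \<and> (even x \<and> odd y \<or> y = Suc x) \<or> y < x \<and> (even y \<and> odd x \<or> x = Suc y)"
    using * by (cases "x < y") (auto simp: le_Suc_eq)
  then show "{x, y} \<in> half_graph n"
    using * unfolding half_graph_def by (fastforce simp: insert_commute)
qed

lemma sgraph_half_graph: "sgraph {..<n} (half_graph n)"
  by (auto simp: sgraph_def half_graph_def)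

lemma hamiltonian_path_half_graph: "hamiltonian_path {..<n} (half_graph n) [0..<n]"
proof -
  have "{[0..<n] ! i, [0..<n] ! Suc i} \<in> half_graph n" if "Suc i < n" for i
    using that by (auto simp: half_graph_iff)
  then show ?thesis by (auto simp: hamiltonian_path_def path_edges_def)
qed

lemma path_edgesI: "Suc i < length vs \<Longrightarrow> {vs ! i, vs ! Suc i} \<in> path_edges vs"
  by (auto simp: path_edges_def)

lemma path_edges_nth_iff:
  assumes "distinct vs" "i < length vs" "j < length vs"
  shows "{vs ! i, vs ! j} \<in> path_edges vs \<longleftrightarrow> j = Suc i \<or> i = Suc j"
  using assms by (auto simp: path_edges_def doubleton_eq_iff nth_eq_iff_index_eq insert_commute)

text \<open>The two end edges of an induced $P_5$ would induce a $2K_2$, while the neighbourhoods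
  in a half graph are nested.\<close>

lemma half_graph_induced_path_le:
  assumes "induced_path {..<n} (half_graph n) p"
  shows "length p \<le> 4"
proof (rule ccontr)
  assume "\<not> ?thesis"
  then have len: "4 < length p" by simp
  then have ne: "p \<noteq> []" by auto
  have dist: "distinct p" and edges: "{e \<in> half_graph n. e \<subseteq> set p} = path_edges p"
    using assms by (auto simp: induced_path_def)
  have adj: "{p ! i, p ! j} \<in> half_graph n \<longleftrightarrow> j = Suc i \<or> i = Suc j"
    if "i < 5" "j < 5" for i j
  proof -
    have "{p ! i, p ! j} \<in> half_graph n \<longleftrightarrow> {p ! i, p ! j} \<in> path_edges p"
      using that len by (simp flip: edges)
    then show ?thesis using path_edges_nth_iff[OF dist] that len by simp
  qed
  have neq: "p ! 0 \<noteq> p ! 3" "p ! 1 \<noteq> p ! 4" using len ne by (auto simp: nth_eq_iff_index_eq[OF dist])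
  have edge: "{p ! 0, p ! 1} \<in> half_graph n" "{p ! 1, p ! 2} \<in> half_graph n"
    "{p ! 2, p ! 3} \<in> half_graph n" "{p ! 3, p ! 4} \<in> half_graph n"
    and nonedge: "{p ! 0, p ! 3} \<notin> half_graph n" "{p ! 1, p ! 4} \<notin> half_graph n"
    by (simp_all add: adj)
  show False
  \<comment> \<open>Write pi for \<open>p ! i\<close>. If p0 is even, the edges and nonedges give p4
    <= p3 + 1 < p0 <= p1 + 1 < p4. The other case is the same with the sides exchanged.\<close>
  proof (cases "even (p ! 0)")
    case True
    then have "odd (p ! 1)" "even (p ! 2)" "odd (p ! 3)" "even (p ! 4)"
      using edge by (simp_all add: half_graph_iff)
    then show False
      using True edge nonedge neq by (simp add: half_graph_iff)
  next
    case False
    then have "even (p ! 1)" "odd (p ! 2)" "even (p ! 3)" "odd (p ! 4)"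
      using edge by (simp_all add: half_graph_iff)
    then show False
      using False edge nonedge neq by (simp add: half_graph_iff)
  qed
qed

text \<open>If the half graph on n vertices avoided the pattern, it would itself witness that
  \<open>g_H us F n\<close> is at most 4. So any n with a larger value works.\<close>

lemma unbounded_imp_half_graph_pattern:
  assumes "\<forall>B :: nat. \<exists>n. enat B < g_H us F n"
  shows "\<exists>n. contains_pattern (half_graph n) [0..<n] us F"
proof -
  obtain n where "enat 4 < g_H us F n" using assms by blast
  have "contains_pattern (half_graph n) [0..<n] us F"
  proof (rule ccontr)
    assume *: "\<not> ?thesis"
    have "g_H us F n \<le> enat 4"
      unfolding g_H_def
    proof (rule Sup_least, elim CollectE exE conjE)
      fix x t
      assume "x = enat t" and t: "\<forall>(V :: nat set) E vs.
        sgraph V E \<and> card V = n \<and> hamiltonian_path V E vs \<and> \<not> contains_pattern E vs us F \<longrightarrow>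
        (\<exists>p. induced_path V E p \<and> t \<le> length p)"
      obtain p where "induced_path {..<n} (half_graph n) p" "t \<le> length p"
        using t[rule_format, of "{..<n}" "half_graph n" "[0..<n]"] *
          sgraph_half_graph hamiltonian_path_half_graph by auto
      then show "x \<le> enat 4" using half_graph_induced_path_le \<open>x = enat t\<close> by fastforce
    qed
    then show False using \<open>enat 4 < _\<close> by simp
  qed
  then show ?thesis by blast
qed

text \<open>Pattern edges land on half graph edges off the zigzag path, and these always go from an
  even vertex to a later odd one. This is why \<open>edge\<close> only asks about such
  pairs.\<close>

lemma contains_pattern_trans:
  assumes H: "contains_pattern (half_graph n) [0..<n] us F"
    and b: "strict_mono_on {..<n} b" "\<And>i. i < n \<Longrightarrow> b i < length vs"
    and edge: "\<And>x y. \<lbrakk>x < y; y < n; even x; odd y\<rbrakk> \<Longrightarrow> {vs ! b x, vs ! b y} \<in> E - path_edges vs"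
  shows "contains_pattern E vs us F"
proof -
  obtain a where a: "strict_mono_on {..<length us} a" "\<And>i. i < length us \<Longrightarrow> a i < n"
    and aF: "\<And>i j. \<lbrakk>i < length us; j < length us; {us ! i, us ! j} \<in> F\<rbrakk> \<Longrightarrow>
       {a i, a j} \<in> half_graph n - path_edges [0..<n]"
    using H unfolding contains_pattern_def by force
  have key: "{vs ! b x, vs ! b y} \<in> E - path_edges vs"
    if "{x, y} \<in> half_graph n - path_edges [0..<n]" "x < y" for x y
  proof -
    have "y < n" "even x \<and> odd y \<or> y = Suc x" using that by (auto simp: half_graph_iff le_Suc_eq)
    moreover have "y \<noteq> Suc x"
      using that \<open>y < n\<close> path_edgesI[of x "[0..<n]"] by auto
    ultimately show ?thesis using edge that(2) by blast
  qed
  have "{vs ! b (a i), vs ! b (a j)} \<in> E - path_edges vs"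
    if "i < length us" "j < length us" "{us ! i, us ! j} \<in> F" for i j
  proof -
    have *: "{a i, a j} \<in> half_graph n - path_edges [0..<n]" using aF that by blast
    then have "a i \<noteq> a j" by (auto simp: half_graph_iff)
    then show ?thesis
      using key[of "a i" "a j"] key[of "a j" "a i"] * by (cases "a i < a j") (auto simp: insert_commute)
  qed
  moreover have "strict_mono_on {..<length us} (b \<circ> a)"
    using a b by (auto simp: strict_mono_on_def)
  ultimately show ?thesis
    unfolding contains_pattern_def using a(2) b(2) by (intro exI[of _ "b \<circ> a"]) auto
qed

section \<open>Shortest forward walks and induced paths\<close>

lemma chordless_geodesic:
  assumes "(i, j) \<in> R\<^sup>*"
  shows "\<exists>m f. f 0 = i \<and> f m = j \<and> (\<forall>k<m. (f k, f (Suc k)) \<in> R) \<and>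
    (\<forall>a b. Suc a < b \<longrightarrow> b \<le> m \<longrightarrow> (f a, f b) \<notin> R)"
proof -
  define m where "m = (LEAST m. (i, j) \<in> R ^^ m)"
  have m: "(i, j) \<in> R ^^ m" and least: "\<And>k. (i, j) \<in> R ^^ k \<Longrightarrow> m \<le> k"
    using assms unfolding m_def rtrancl_is_UN_relpow by (auto intro: LeastI_ex Least_le)
  obtain f where f: "f 0 = i" "f m = j" "\<And>k. k < m \<Longrightarrow> (f k, f (Suc k)) \<in> R"
    using m unfolding relpow_fun_conv by blast
  have seg: "(f a, f (a + c)) \<in> R ^^ c" if "a + c \<le> m" for a c
    unfolding relpow_fun_conv using f(3) that by (intro exI[of _ "\<lambda>k. f (a + k)"]) auto
  have "(f a, f b) \<notin> R" if "Suc a < b" "b \<le> m" for a b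
  proof
    \<comment> \<open>Following the chord from \<open>f a\<close> to \<open>f b\<close> skips at
      least one step, against the minimality of \<open>m\<close>.\<close>
    assume "(f a, f b) \<in> R"
    moreover have "(i, f a) \<in> R ^^ a" using seg[of 0 a] f that by simp
    ultimately have "(i, f b) \<in> R ^^ Suc a" by auto
    moreover have "(f b, j) \<in> R ^^ (m - b)" using seg[of b "m - b"] f that by simp
    ultimately have "(i, j) \<in> R ^^ (Suc a + (m - b))" unfolding relpow_add by blast
    then show False using least that by fastforce
  qed
  then show ?thesis using f by blast
qed

text \<open>Edges are directed from left to right along \<open>vs\<close>, so directed walks inside
  \<open>X\<close> are exactly increasing paths.\<close>

definition fwd :: "'a set set \<Rightarrow> 'a list \<Rightarrow> nat set \<Rightarrow> (nat \<times> nat) set" where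
  "fwd E vs X = {(x, y). x \<in> X \<and> y \<in> X \<and> x < y \<and> {vs ! x, vs ! y} \<in> E}"

lemma fwd_walk_mono:
  assumes "\<And>k. k < m \<Longrightarrow> (f k, f (Suc k)) \<in> fwd E vs X" "a < b" "b \<le> m"
  shows "f a < f b"
  using assms(2,3)
proof (induction b)
  case (Suc b)
  have "f b < f (Suc b)" using assms(1)[of b] Suc.prems by (simp add: fwd_def)
  then show ?case using Suc by (cases "a = b") auto
qed simp

text \<open>Along a forward walk the positions increase, so every edge of the graph between two of
  its vertices is again a forward step inside \<open>X\<close>. A chordless walk is therefore
  induced in the whole graph. The walk \<open>f\<close> is returned too, since its passage through
  \<open>X\<close> is examined later.\<close>

lemma fwd_geodesic:
  assumes G: "sgraph V E" "hamiltonian_path V E vs" and X: "X \<subseteq> {..<length vs}"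
    and "i \<in> X" and reach: "(i, j) \<in> (fwd E vs X)\<^sup>*"
  shows "\<exists>m f. f 0 = i \<and> f m = j \<and> (\<forall>k<m. (f k, f (Suc k)) \<in> fwd E vs X) \<and>
    induced_path V E (map (\<lambda>k. vs ! f k) [0..<Suc m]) \<and>
    increasing_wrt vs (map (\<lambda>k. vs ! f k) [0..<Suc m])"
proof -
  obtain m f where f: "f 0 = i" "f m = j" "\<And>k. k < m \<Longrightarrow> (f k, f (Suc k)) \<in> fwd E vs X"
    and chordless: "\<And>a b. \<lbrakk>Suc a < b; b \<le> m\<rbrakk> \<Longrightarrow> (f a, f b) \<notin> fwd E vs X"
    using chordless_geodesic[OF reach] by blast
  have mono: "f a < f b" if "a < b" "b \<le> m" for a b
    using fwd_walk_mono[of m f] f(3) that by blast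
  have fX: "f k \<in> X" if "k \<le> m" for k
  proof (cases k)
    case 0
    then show ?thesis using f(1) \<open>i \<in> X\<close> by simp
  next
    case (Suc l)
    then show ?thesis using f(3)[of l] that by (simp add: fwd_def)
  qed
  then have fn: "f k < length vs" if "k \<le> m" for k using X that by auto
  have dvs: "distinct vs" and setvs: "set vs = V" using G by (auto simp: hamiltonian_path_def)
  define p where "p = map (\<lambda>k. vs ! f k) [0..<Suc m]"
  have lenp: "length p = Suc m" by (simp add: p_def)
  have nth: "p ! k = vs ! f k" if "k \<le> m" for k using that by (simp add: p_def del: upt_Suc)
  have setp: "set p = (\<lambda>k. vs ! f k) ` {..m}"
    by (simp add: p_def atLeast0LessThan lessThan_Suc_atMost del: upt_Suc)
  have inj: "vs ! f a = vs ! f b \<longleftrightarrow> a = b" if "a \<le> m" "b \<le> m" for a b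
    using that mono[of a b] mono[of b a] fn nth_eq_iff_index_eq[OF dvs, of "f a" "f b"]
    by (cases a b rule: linorder_cases) auto
  have "{e \<in> E. e \<subseteq> set p} = path_edges p"
  proof
    show "path_edges p \<subseteq> {e \<in> E. e \<subseteq> set p}"
    proof
      fix e assume "e \<in> path_edges p"
      then obtain k where k: "k < m" "e = {p ! k, p ! Suc k}" by (auto simp: path_edges_def lenp)
      then have "e = {vs ! f k, vs ! f (Suc k)}" by (simp add: nth)
      then show "e \<in> {e \<in> E. e \<subseteq> set p}" using f(3)[OF k(1)] k(1) by (auto simp: fwd_def setp)
    qed
  next
    have edge: "{vs ! f a, vs ! f b} \<in> path_edges p"
      if "a < b" "b \<le> m" "{vs ! f a, vs ! f b} \<in> E" for a b
    proof -
      have "(f a, f b) \<in> fwd E vs X" using that mono fX by (simp add: fwd_def)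
      then have "b = Suc a" using chordless[of a b] that by fastforce
      then show ?thesis using path_edgesI[of a p] that by (simp add: lenp nth)
    qed
    show "{e \<in> E. e \<subseteq> set p} \<subseteq> path_edges p"
    proof
      fix e assume e: "e \<in> {e \<in> E. e \<subseteq> set p}"
      then have "card e = 2" using G by (auto simp: sgraph_def)
      then obtain u v where uv: "e = {u, v}" "u \<noteq> v" by (auto simp: card_2_iff)
      then obtain a b where ab: "a \<le> m" "b \<le> m" "u = vs ! f a" "v = vs ! f b"
        using e by (auto simp: setp)
      then have "a \<noteq> b" using uv by auto
      then show "e \<in> path_edges p"
        using edge[of a b] edge[of b a] ab uv e by (cases "a < b") (auto simp: insert_commute)
    qed
  qed
  moreover have "distinct p"
    unfolding distinct_conv_nth lenp using nth inj by (metis less_Suc_eq_le)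
  moreover have "set p \<subseteq> V" unfolding setp using fn setvs by auto
  ultimately have "induced_path V E p" using lenp by (auto simp: induced_path_def)
  moreover have "increasing_wrt vs p"
    unfolding increasing_wrt_def
  proof (intro exI[of _ "map f [0..<Suc m]"] conjI)
    show "sorted_wrt (<) (map f [0..<Suc m])"
      unfolding sorted_wrt_iff_nth_less using mono by (simp del: upt_Suc)
    show "set (map f [0..<Suc m]) \<subseteq> {..<length vs}" using fn by (auto simp: less_Suc_eq_le)
    show "p = map ((!) vs) (map f [0..<Suc m])" by (simp add: p_def)
  qed
  ultimately show ?thesis using f unfolding p_def by blast
qed

section \<open>Colouring quadruples by adjacencies between connecting paths\<close>

lemma long_increasing_induced_path:
  fixes vs :: "'a list"
  assumes H: "contains_pattern (half_graph k) [0..<k] us F"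
    and G: "sgraph V E" "hamiltonian_path V E vs" "\<not> contains_pattern E vs us F"
    and size: "er (Suc (t * t)) (t + 2 + 3 * k) 3 \<le> length vs"
  shows "\<exists>p. induced_path V E p \<and> increasing_wrt vs p \<and> t < length p"
proof (rule ccontr)
  assume "\<not> ?thesis"
  then have short: "length p \<le> t" if "induced_path V E p" "increasing_wrt vs p" for p
    using that by (meson not_le)
  define n where "n = length vs"
  \<comment> \<open>This serves both cases: t + 2 points when the colour is \<open>None\<close>, and
    3k + 2 points for the half graph.\<close>
  define s where "s = t + 2 + 3 * k"
  have dvs: "distinct vs" and path: "path_edges vs \<subseteq> E" using G by (auto simp: hamiltonian_path_def)
  define walk where "walk i j L P \<longleftrightarrow> P 0 = i \<and> P L = j \<and>
    (\<forall>l<L. (P l, P (Suc l)) \<in> fwd E vs {..<n}) \<and> L < t" for i j L P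
  have "\<exists>L P. walk i j L P"
    if "i < j" "j < n" for i j
  proof -
    \<comment> \<open>The Hamiltonian path itself supplies a forward walk from \<open>i\<close> to
      \<open>j\<close>, so a geodesic exists.\<close>
    have "(i, i + d) \<in> (fwd E vs {..<n})\<^sup>*" if "i + d < n" for d
      using that
    proof (induction d)
      case (Suc d)
      then have "(i + d, i + Suc d) \<in> fwd E vs {..<n}"
        using path path_edgesI[of "i + d" vs] by (auto simp: fwd_def n_def)
      then show ?case using Suc by (simp add: rtrancl_into_rtrancl)
    qed simp
    from this[of "j - i"] have "(i, j) \<in> (fwd E vs {..<n})\<^sup>*" using that by simp
    then obtain L P where P: "P 0 = i" "P L = j" "\<forall>l<L. (P l, P (Suc l)) \<in> fwd E vs {..<n}"
      "induced_path V E (map (\<lambda>k. vs ! P k) [0..<Suc L])"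
      "increasing_wrt vs (map (\<lambda>k. vs ! P k) [0..<Suc L])"
      using fwd_geodesic[OF G(1,2), of "{..<n}" i j] \<open>i < j\<close> \<open>j < n\<close>
      unfolding n_def by fastforce
    \<comment> \<open>The geodesic has L + 1 vertices, so its positions 0, ..., L are all below
      t.\<close>
    then have "L < t" using short by fastforce
    then show ?thesis using P unfolding walk_def by blast
  qed
  then obtain L P where walk: "\<And>i j. \<lbrakk>i < j; j < n\<rbrakk> \<Longrightarrow> walk i j (L i j) (P i j)"
    by metis
  then have P: "\<And>i j. \<lbrakk>i < j; j < n\<rbrakk> \<Longrightarrow> P i j 0 = i"
    "\<And>i j. \<lbrakk>i < j; j < n\<rbrakk> \<Longrightarrow> P i j (L i j) = j"
    "\<And>i j l. \<lbrakk>i < j; j < n; l < L i j\<rbrakk> \<Longrightarrow> (P i j l, P i j (Suc l)) \<in> fwd E vs {..<n}"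
    "\<And>i j. \<lbrakk>i < j; j < n\<rbrakk> \<Longrightarrow> L i j < t"
    unfolding walk_def by blast+
  have P_between: "i \<le> P i j l" "P i j l \<le> j" if "i < j" "j < n" "l \<le> L i j" for i j l
  proof -
    have mono: "P i j a < P i j b" if "a < b" "b \<le> L i j" for a b
      using fwd_walk_mono[of "L i j" "P i j" E vs "{..<n}" a b] P(3)[OF \<open>i < j\<close> \<open>j < n\<close>] that by blast
    show "i \<le> P i j l" using mono[of 0 l] P(1)[of i j] that by (cases "l = 0") auto
    show "P i j l \<le> j" using mono[of l "L i j"] P(2)[of i j] that by (cases "l = L i j") auto
  qed
  define Q where "Q a b c d = {(p, q). p \<le> L a b \<and> q \<le> L c d \<and> {vs ! P a b p, vs ! P c d q} \<in> E}"
    for a b c d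
  \<comment> \<open>Sorting recovers the order of the quadruple. The colour names one chosen
    adjacent pair of positions, so on a homogeneous set the same pair works for all
    quadruples.\<close>
  define col where "col A = (let xs = sorted_list_of_set A; D = Q (xs ! 0) (xs ! 1) (xs ! 2) (xs ! 3)
      in if D = {} then None else Some (SOME z. z \<in> D))" for A
  define C where "C = insert None (Some ` ({..<t} \<times> {..<t}))"
  have col: "col {a, b, c, d} = (if Q a b c d = {} then None else Some (SOME z. z \<in> Q a b c d))"
    if "a < b" "b < c" "c < d" for a b c d
  proof -
    have "sorted_list_of_set (set [a, b, c, d]) = [a, b, c, d]"
      using that by (intro sorted_list_of_set.idem_if_sorted_distinct) auto
    then show ?thesis by (simp add: col_def Let_def numeral_2_eq_2 numeral_3_eq_3)
  qed
  have "col ` nsets {..<n} (Suc 3) \<subseteq> C"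
  proof
    fix y assume "y \<in> col ` nsets {..<n} (Suc 3)"
    then obtain a b c d where abcd: "y = col {a, b, c, d}" "a < b" "b < c" "c < d" "d < n"
      using ordered_nsets_4_eq[of "{..<n}"] by auto
    show "y \<in> C"
    proof (cases "Q a b c d = {}")
      case False
      then have "(SOME z. z \<in> Q a b c d) \<in> Q a b c d" by (simp add: some_in_eq)
      moreover have "Q a b c d \<subseteq> {..<t} \<times> {..<t}"
        using P(4)[of a b] P(4)[of c d] abcd by (auto simp: Q_def)
      ultimately show ?thesis using abcd col False by (auto simp: C_def)
    qed (use abcd col in \<open>simp add: C_def\<close>)
  qed
  moreover have "card C \<le> Suc (t * t)"
    by (simp add: C_def card_insert_if card_image card_cartesian_product)
  moreover have "finite C" by (simp add: C_def)
  ultimately obtain T c where T: "T \<subseteq> {..<n}" "card T = s" and hom: "\<And>A. A \<in> nsets T (Suc 3) \<Longrightarrow> col A = c"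
    using erdos_rado[of "{..<n}" C "Suc (t * t)" s col 3] size unfolding n_def s_def by auto
  have finT: "finite T" using T finite_subset by blast
  define \<sigma> where "\<sigma> i = sorted_list_of_set T ! i" for i
  have \<sigma>_mono: "\<sigma> i < \<sigma> j" if "i < j" "j < s" for i j
    unfolding \<sigma>_def using that T finT by (intro sorted_wrt_nth_less[of "(<)"]) auto
  have \<sigma>_T: "\<sigma> i \<in> T" if "i < s" for i
    unfolding \<sigma>_def using that T finT by (metis nth_mem set_sorted_list_of_set length_sorted_list_of_set)
  then have \<sigma>_n: "\<sigma> i < n" if "i < s" for i using that T by auto
  have hom': "c = (if Q (\<sigma> w) (\<sigma> x) (\<sigma> y) (\<sigma> z) = {} then None
      else Some (SOME u. u \<in> Q (\<sigma> w) (\<sigma> x) (\<sigma> y) (\<sigma> z)))"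
    if "w < x" "x < y" "y < z" "z < s" for w x y z
  proof -
    have "\<sigma> w < \<sigma> x" "\<sigma> x < \<sigma> y" "\<sigma> y < \<sigma> z" using \<sigma>_mono that by simp_all
    moreover from this have "{\<sigma> w, \<sigma> x, \<sigma> y, \<sigma> z} \<in> nsets T (Suc 3)"
      using \<sigma>_T that by (auto simp: nsets_def)
    ultimately show ?thesis using col hom by metis
  qed
  show False
  proof (cases c)
    case None
    \<comment> \<open>The four indices must be distinct, so this says nothing about two consecutive
      pieces.\<close>
    have none: "{vs ! P (\<sigma> w) (\<sigma> x) p, vs ! P (\<sigma> y) (\<sigma> z) q} \<notin> E"
      if "w < x" "x < y" "y < z" "z < s" "p \<le> L (\<sigma> w) (\<sigma> x)" "q \<le> L (\<sigma> y) (\<sigma> z)" for w x y z p q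
      using hom'[OF that(1-4)] None that(5,6) by (auto simp: Q_def split: if_splits)
    define X where "X = {P (\<sigma> i) (\<sigma> (Suc i)) l | i l. Suc i < s \<and> l \<le> L (\<sigma> i) (\<sigma> (Suc i))}"
    have lt: "\<sigma> i < \<sigma> (Suc i)" "\<sigma> (Suc i) < n" if "Suc i < s" for i
      using \<sigma>_mono[of i "Suc i"] \<sigma>_n that by auto
    have "X \<subseteq> {..<n}"
      using P_between(2)[OF lt] lt(2) unfolding X_def by force
    have XI: "P (\<sigma> i) (\<sigma> (Suc i)) l \<in> X" if "Suc i < s" "l \<le> L (\<sigma> i) (\<sigma> (Suc i))" for i l
      using that by (auto simp: X_def)
    have reach1: "(\<sigma> i, P (\<sigma> i) (\<sigma> (Suc i)) l) \<in> (fwd E vs X)\<^sup>*"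
      if "Suc i < s" "l \<le> L (\<sigma> i) (\<sigma> (Suc i))" for i l
      using that(2)
    proof (induction l)
      case 0
      then show ?case using P(1)[OF lt[OF that(1)]] by simp
    next
      case (Suc l)
      then have "(P (\<sigma> i) (\<sigma> (Suc i)) l, P (\<sigma> i) (\<sigma> (Suc i)) (Suc l)) \<in> fwd E vs X"
        using P(3)[OF lt[OF that(1)], of l] XI that(1) by (simp add: fwd_def)
      then show ?case using Suc by (simp add: rtrancl_into_rtrancl)
    qed
    have reach: "(\<sigma> 0, \<sigma> i) \<in> (fwd E vs X)\<^sup>*" if "i < s" for i
      using that
    proof (induction i)
      case (Suc i)
      then show ?case
        using reach1[of i "L (\<sigma> i) (\<sigma> (Suc i))"] P(2)[OF lt[of i]]
        by (metis Suc_lessD order_refl rtrancl_trans)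
    qed simp
    have "1 < s" "t + 1 < s" by (simp_all add: s_def)
    have "\<sigma> 0 \<in> X" using XI[of 0 0] P(1)[OF lt[of 0]] \<open>1 < s\<close> by simp
    then obtain m f where f: "f 0 = \<sigma> 0" "f m = \<sigma> (t + 1)"
      "\<And>k. k < m \<Longrightarrow> (f k, f (Suc k)) \<in> fwd E vs X"
      "induced_path V E (map (\<lambda>k. vs ! f k) [0..<Suc m])"
      "increasing_wrt vs (map (\<lambda>k. vs ! f k) [0..<Suc m])"
      using fwd_geodesic[OF G(1,2) \<open>X \<subseteq> {..<n}\<close>[unfolded n_def] _ reach[OF \<open>t + 1 < s\<close>]] by blast
    have "m < t" using short[OF f(4,5)] by simp
    \<comment> \<open>After j steps the geodesic is in a piece of index at most j, because an edge
      from piece i to a piece beyond i + 1 would contradict \<open>none\<close>.\<close>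
    have slow: "\<exists>i l. i \<le> j \<and> Suc i < s \<and> l \<le> L (\<sigma> i) (\<sigma> (Suc i)) \<and> f j = P (\<sigma> i) (\<sigma> (Suc i)) l"
      if "j \<le> m" for j
      using that
    proof (induction j)
      case 0
      show ?case
        using P(1)[OF lt[of 0]] \<open>1 < s\<close> f(1) by (intro exI[of _ 0]) auto
    next
      case (Suc j)
      then obtain i l where il: "i \<le> j" "Suc i < s" "l \<le> L (\<sigma> i) (\<sigma> (Suc i))"
        "f j = P (\<sigma> i) (\<sigma> (Suc i)) l" by auto
      have *: "f (Suc j) \<in> X" "{vs ! f j, vs ! f (Suc j)} \<in> E"
        using f(3)[of j] Suc.prems by (auto simp: fwd_def)
      then obtain i' l' where il': "Suc i' < s" "l' \<le> L (\<sigma> i') (\<sigma> (Suc i'))"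
        "f (Suc j) = P (\<sigma> i') (\<sigma> (Suc i')) l'" by (auto simp: X_def)
      have "\<not> Suc i < i'" using none[of i "Suc i" i' "Suc i'" l l'] il il' * by auto
      then have "i' \<le> Suc j" using il by simp
      then show ?case using il' by blast
    qed
    obtain i l where "i \<le> m" "Suc i < s" "l \<le> L (\<sigma> i) (\<sigma> (Suc i))" "f m = P (\<sigma> i) (\<sigma> (Suc i)) l"
      using slow[of m] by auto
    \<comment> \<open>The end \<open>\<sigma> (t + 1)\<close> lies in a piece i with i <= m < t,
      whose last point is \<open>\<sigma> (Suc i)\<close>. That point comes strictly
      earlier.\<close>
    then have "\<sigma> (t + 1) \<le> \<sigma> (Suc i)" using P_between(2)[OF lt] f(2) by metis
    moreover have "\<sigma> (Suc i) < \<sigma> (t + 1)" using \<sigma>_mono \<open>i \<le> m\<close> \<open>m < t\<close> \<open>t + 1 < s\<close> by simp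
    ultimately show False by simp
  next
    case (Some pair)
    obtain p q where "pair = (p, q)" by fastforce
    have pq: "p \<le> L (\<sigma> w) (\<sigma> x) \<and> q \<le> L (\<sigma> y) (\<sigma> z) \<and> {vs ! P (\<sigma> w) (\<sigma> x) p, vs ! P (\<sigma> y) (\<sigma> z) q} \<in> E"
      if "w < x" "x < y" "y < z" "z < s" for w x y z
    proof -
      have "(p, q) \<in> Q (\<sigma> w) (\<sigma> x) (\<sigma> y) (\<sigma> z)"
        using hom'[OF that] Some \<open>pair = (p, q)\<close> by (auto simp: some_in_eq split: if_splits dest!: sym[of _ "Some _"] intro: someI_ex)
      then show ?thesis by (simp add: Q_def)
    qed
    \<comment> \<open>Vertex \<open>i\<close> of the half graph is taken on the path between the
      points numbered 3i and 3i + 1. The point numbered 3i + 2 is a spacer.\<close>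
    define b where "b i = P (\<sigma> (3 * i)) (\<sigma> (3 * i + 1)) (if even i then p else q)" for i
    have b: "\<sigma> (3 * i) \<le> b i" "b i \<le> \<sigma> (3 * i + 1)" if "i < k" for i
    proof -
      \<comment> \<open>\<open>pq\<close> bounds a position only within a full quadruple. For even
        \<open>i\<close> the pair 3k, 3k + 1 completes it on the right; an odd \<open>i\<close> is
        positive, so the pair 0, 1 completes it on the left.\<close>
      have "(if even i then p else q) \<le> L (\<sigma> (3 * i)) (\<sigma> (3 * i + 1))"
      proof (cases "even i")
        case True
        then show ?thesis using pq[of "3 * i" "3 * i + 1" "3 * k" "3 * k + 1"] that by (simp add: s_def)
      next
        case False
        then have "0 < i" by (auto intro: gr0I)
        then show ?thesis using False pq[of 0 1 "3 * i" "3 * i + 1"] that by (simp add: s_def)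
      qed
      moreover have "\<sigma> (3 * i) < \<sigma> (3 * i + 1)" "\<sigma> (3 * i + 1) < n"
        using \<sigma>_mono \<sigma>_n that by (simp_all add: s_def)
      ultimately show "\<sigma> (3 * i) \<le> b i" "b i \<le> \<sigma> (3 * i + 1)"
        using P_between unfolding b_def by blast+
    qed
    \<comment> \<open>The spacer forces a gap of at least two positions, so the edges found are not
      edges of the Hamiltonian path.\<close>
    have b_mono: "Suc (b x) < b y" if "x < y" "y < k" for x y
    proof -
      have "b x \<le> \<sigma> (3 * x + 1)" "\<sigma> (3 * y) \<le> b y" using b that by auto
      moreover have "\<sigma> (3 * x + 1) < \<sigma> (3 * x + 2)" "\<sigma> (3 * x + 2) < \<sigma> (3 * y)"
        using that by (auto intro!: \<sigma>_mono simp: s_def)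
      ultimately show ?thesis by linarith
    qed
    have bn: "b i < length vs" if "i < k" for i
    proof -
      have "\<sigma> (3 * i + 1) < n" using \<sigma>_n that by (simp add: s_def)
      then show ?thesis using b(2)[OF that] by (simp add: n_def)
    qed
    have b_smono: "strict_mono_on {..<k} b"
      unfolding strict_mono_on_def using b_mono by (auto dest: Suc_lessD)
    have b_edge: "{vs ! b x, vs ! b y} \<in> E - path_edges vs" if "x < y" "y < k" "even x" "odd y" for x y
      using pq[of "3 * x" "3 * x + 1" "3 * y" "3 * y + 1"] that b_mono[of x y] bn[of x] bn[of y]
      by (simp add: b_def[of x] b_def[of y] path_edges_nth_iff[OF dvs] s_def)
    have "contains_pattern E vs us F"
      by (rule contains_pattern_trans[OF H b_smono], rule bn, assumption, rule b_edge, assumption+)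
    then show False using G(3) by contradiction
  qed
qed

text \<open>The vertex type is left arbitrary because the result is used twice: at the type in the
  theorem and at \<open>nat\<close>, over which \<open>g_H\<close> quantifies.\<close>

lemma eventually_long_increasing_induced_path:
  assumes "\<forall>B :: nat. \<exists>n. enat B < g_H us F n"
  shows "\<exists>N. \<forall>n\<ge>N. \<forall>(V :: 'a set) E vs.
    sgraph V E \<longrightarrow> card V = n \<longrightarrow> hamiltonian_path V E vs \<longrightarrow> \<not> contains_pattern E vs us F \<longrightarrow>
    (\<exists>p. induced_path V E p \<and> increasing_wrt vs p \<and>
      1/8 * (iter_log 3 (real n) / iter_log 4 (real n)) powr (1/3) \<le> real (length p))"
proof -
  obtain k where H: "contains_pattern (half_graph k) [0..<k] us F"
    using unbounded_imp_half_graph_pattern[OF assms] by blast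
  define x where "x n = 1/8 * (iter_log 3 (real n) / iter_log 4 (real n)) powr (1/3)" for n :: nat
  define t where "t n = nat \<lfloor>x n\<rfloor>" for n
  obtain N where N: "\<And>n. N \<le> n \<Longrightarrow> er (Suc (t n * t n)) (t n + 2 + 3 * k) 3 \<le> n"
    using eventually_er_le[of k] unfolding eventually_at_top_linorder t_def x_def by blast
  have "\<exists>p. induced_path V E p \<and> increasing_wrt vs p \<and> x n \<le> real (length p)"
    if "N \<le> n" "sgraph V E" "card V = n" "hamiltonian_path V E vs" "\<not> contains_pattern E vs us F"
    for n and V :: "'a set" and E vs
  proof -
    have "length vs = n" using that by (auto simp: hamiltonian_path_def distinct_card)
    then have "\<exists>p. induced_path V E p \<and> increasing_wrt vs p \<and> t n < length p"
      using long_increasing_induced_path[OF H that(2,4,5), of "t n"] N[OF that(1)] by simp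
    \<comment> \<open>A strict bound above the floor \<open>t n\<close> recovers the real number
      \<open>x n\<close> with no loss in the constant.\<close>
    moreover have "x n \<le> real l" if "t n < l" for l using that unfolding t_def by linarith
    ultimately show ?thesis by blast
  qed
  then show ?thesis unfolding x_def by blast
qed

theorem theorem14:
  fixes us :: "'b list" and F :: "'b set set"
  assumes "ordered_graph us F"
    and "\<forall>B :: nat. \<exists>n. enat B < g_H us F n"
  shows "(\<exists>c>0. \<exists>N. \<forall>n\<ge>N. \<forall>(V :: 'a set) E vs.
            sgraph V E \<longrightarrow> card V = n \<longrightarrow> hamiltonian_path V E vs \<longrightarrow>
            \<not> contains_pattern E vs us F \<longrightarrow>
            (\<exists>p. induced_path V E p \<and> increasing_wrt vs p \<and>
               real (length p) \<ge> c * (iter_log 3 (real n) / iter_log 4 (real n)) powr (1/3)))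
       \<and> (\<exists>c>0. \<exists>N. \<forall>n\<ge>N.
            ereal_of_enat (g_H us F n)
              \<ge> ereal (c * (iter_log 3 (real n) / iter_log 4 (real n)) powr (1/3)))"
proof -
  define x where "x n = 1/8 * (iter_log 3 (real n) / iter_log 4 (real n)) powr (1/3)" for n :: nat
  obtain N where N: "\<forall>n\<ge>N. \<forall>(V :: nat set) E vs.
    sgraph V E \<longrightarrow> card V = n \<longrightarrow> hamiltonian_path V E vs \<longrightarrow> \<not> contains_pattern E vs us F \<longrightarrow>
    (\<exists>p. induced_path V E p \<and> increasing_wrt vs p \<and> x n \<le> real (length p))"
    using eventually_long_increasing_induced_path[OF assms(2)] unfolding x_def by blast
  have "ereal (x n) \<le> ereal_of_enat (g_H us F n)" if "N \<le> n" for n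
  proof -
    \<comment> \<open>Path lengths are integers, so the bound may be rounded up. Then
      \<open>u\<close> is admissible in the supremum defining \<open>g_H\<close>, whether that
      supremum is finite or not.\<close>
    define u where "u = nat \<lceil>x n\<rceil>"
    have "\<exists>p. induced_path V E p \<and> u \<le> length p"
      if G: "sgraph V E \<and> card V = n \<and> hamiltonian_path V E vs \<and> \<not> contains_pattern E vs us F"
      for V :: "nat set" and E vs
    proof -
      obtain p where "induced_path V E p" "x n \<le> real (length p)"
        using N \<open>N \<le> n\<close> G by blast
      moreover from this have "u \<le> length p" unfolding u_def by linarith
      ultimately show ?thesis by blast
    qed
    then have "enat u \<le> g_H us F n" unfolding g_H_def by (intro Sup_upper) blast
    then have "ereal (real u) \<le> ereal_of_enat (g_H us F n)"
      by (metis ereal_of_enat_le_iff ereal_of_enat_simps(1))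
    moreover have "x n \<le> real u" unfolding u_def by linarith
    ultimately show ?thesis by (meson ereal_less_eq(3) order_trans)
  qed
  then have "\<exists>c>0. \<exists>N. \<forall>n\<ge>N. ereal_of_enat (g_H us F n)
      \<ge> ereal (c * (iter_log 3 (real n) / iter_log 4 (real n)) powr (1/3))"
    unfolding x_def by (intro exI[of _ "1/8"] conjI exI[of _ N]) auto
  moreover have "\<exists>c>0. \<exists>N. \<forall>n\<ge>N. \<forall>(V :: 'a set) E vs.
      sgraph V E \<longrightarrow> card V = n \<longrightarrow> hamiltonian_path V E vs \<longrightarrow> \<not> contains_pattern E vs us F \<longrightarrow>
      (\<exists>p. induced_path V E p \<and> increasing_wrt vs p \<and>
        real (length p) \<ge> c * (iter_log 3 (real n) / iter_log 4 (real n)) powr (1/3))"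
    using eventually_long_increasing_induced_path[OF assms(2)] by (intro exI[of _ "1/8"] conjI) auto
  ultimately show ?thesis by blast
qed

end
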